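(* Let $N\ge 1$ and $n\ge 1$ be integers and let $X_1,\dots,X_n$ be independent random vectors, each uniformly distributed on the unit sphere $S^{N-1}\subset\mathbb{R}^N$. Then for all real numbers $a_1,\dots,a_n$, \[ \Big\|\sum_{j=1}^n a_jX_j\Big\|_{\psi_2}\le b(N)\Big(\sum_{j=1}^n a_j^2\Big)^{1/2},\qquad b(N):=\sqrt{\frac{2}{N}}\sqrt{\frac{1}{1-(1/2)^{2/N}}}. \] Moreover the constant $b(N)$ is optimal: for every $c<b(N)$ there exist $n\in\mathbb{N}$ and $a_1,\dots,a_n\in\mathbb{R}$ such that $\|\sum_{j=1}^n a_jX_j\|_{\psi_2}> c\,(\sum_{j=1}^n a_j^2)^{1/2}$ for i.i.d. $X_j$ uniformly distributed on $S^{N-1}$.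
   Context: For $q>0$ let $\psi_q(x)=\exp(x^q)-1$. For an $\mathbb{R}^N$-valued random vector $X$ on a probability space, its Orlicz $\psi_2$-norm is $\|X\|_{\psi_2}=\inf\{c>0:\ \mathbb{E}\,\psi_2(\|X\|/c)\le 1\}=\inf\{c>0:\ \mathbb{E}\exp(\|X\|^2/c^2)\le 2\}$, where $\|\cdot\|$ denotes the Euclidean norm on $\mathbb{R}^N$. *)

theory Defs
  imports "HOL-Probability.Probability"
begin

text \<open>Uniform (normalized surface) measure on the unit sphere of real^n:
  push-forward of the uniform distribution on the closed unit ball under
  radial projection y \<mapsto> y / |y| (sgn).\<close>
definition sphere_unif :: "(real ^ 'n) measure" where
  "sphere_unif = distr (uniform_measure lborel (cball 0 1)) borel sgn"

definition psi2_norm :: "'s measure \<Rightarrow> ('s \<Rightarrow> 'b::real_normed_vector) \<Rightarrow> real" where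
  "psi2_norm M Z = Inf {c::real. c > 0 \<and>
     (\<integral>\<^sup>+ \<omega>. ennreal (exp ((norm (Z \<omega>))\<^sup>2 / c\<^sup>2)) \<partial>M) \<le> 2}"

definition bconst :: "nat \<Rightarrow> real" where
  "bconst N = sqrt (2 / real N) * sqrt (1 / (1 - (1/2) powr (2 / real N)))"

end

theory Submission
  imports Defs
begin

text \<open>
  Let \<open>g\<close> be a standard Gaussian vector in dimension \<open>N\<close>. Since \<open>exp (|s|\<^sup>2 / 2) = E exp (s \<bullet> g)\<close>,
  for \<open>S = \<Sum>\<^sub>j a\<^sub>j X\<^sub>j\<close> one has \<open>E exp (l |S|\<^sup>2) = E\<^sub>g \<Prod>\<^sub>j L (sqrt (2 l) a\<^sub>j g)\<close> with
  \<open>L y = E exp (X \<bullet> y)\<close> the Laplace transform of the sphere. Comparing the even moments of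
  \<open>X \<bullet> y\<close> with Gaussian ones gives \<open>1 + |y|\<^sup>2 / (2 N) \<le> L y \<le> exp (|y|\<^sup>2 / (2 N))\<close>.
  The right inequality bounds \<open>E exp (l |S|\<^sup>2)\<close> by \<open>E exp (l A |g|\<^sup>2 / N) = (1 - 2 l A / N) powr (- N / 2)\<close>,
  where \<open>A = \<Sum>\<^sub>j a\<^sub>j\<^sup>2\<close>, and \<open>bconst N\<close> is exactly the scale at which this equals 2.
  For equal weights the left inequality and Fatou's lemma show that the bound is attained
  in the limit \<open>n \<rightarrow> \<infinity>\<close>.
\<close>

section \<open>Euclidean preliminaries and the invariance of Lebesgue measure\<close>

lemma power2_norm_eq_sum_Basis: "(norm x)\<^sup>2 = (\<Sum>b\<in>Basis. (x \<bullet> b)\<^sup>2)"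
  for x :: "'a::euclidean_space"
  unfolding power2_norm_eq_inner by (subst euclidean_inner) (simp add: power2_eq_square)

lemma nn_integral_lborel_translate:
  fixes f :: "'a::euclidean_space \<Rightarrow> ennreal"
  assumes [measurable]: "f \<in> borel_measurable borel"
  shows "(\<integral>\<^sup>+ x. f (c + x) \<partial>lborel) = (\<integral>\<^sup>+ x. f x \<partial>lborel)"
proof -
  have "(\<integral>\<^sup>+ x. f x \<partial>lborel) = (\<integral>\<^sup>+ x. f x \<partial>distr lborel borel ((+) c))"
    by (simp add: lborel_distr_plus)
  also have "\<dots> = (\<integral>\<^sup>+ x. f (c + x) \<partial>lborel)"
    by (subst nn_integral_distr) auto
  finally show ?thesis by simp
qed

lemma emeasure_lborel_unit_cball_pos: "0 < emeasure lborel (cball (0::'a::euclidean_space) 1)"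
  using content_cball_pos[of 1 "0::'a"]
  by (simp add: measure_def zero_less_iff_neq_zero) (metis enn2real_0 less_irrefl)

lemma borel_measurable_linear:
  fixes T :: "'a::euclidean_space \<Rightarrow> 'b::euclidean_space"
  shows "linear T \<Longrightarrow> T \<in> borel_measurable borel"
  by (intro borel_measurable_continuous_onI linear_continuous_on)
    (simp add: linear_conv_bounded_linear)

text \<open>Uniqueness of Haar measure: integrate \<open>f (T x) * g (y - T x)\<close> over \<open>x\<close> and \<open>y\<close> in both orders,
  with \<open>g\<close> the indicator of the unit ball, which \<open>T\<close> preserves.\<close>
lemma nn_integral_lborel_orthogonal:
  fixes f :: "'a::euclidean_space \<Rightarrow> ennreal" and T :: "'a \<Rightarrow> 'a"
  assumes T: "orthogonal_transformation T" and f[measurable]: "f \<in> borel_measurable borel"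
  shows "(\<integral>\<^sup>+ x. f (T x) \<partial>lborel) = (\<integral>\<^sup>+ x. f x \<partial>lborel)"
proof -
  have lin: "linear T"
    using T by (rule orthogonal_transformation_linear)
  have [measurable]: "T \<in> borel_measurable borel"
    by (rule borel_measurable_linear[OF lin])
  have T': "T (inv T y) = y" for y
    by (rule surj_f_inv_f[OF orthogonal_transformation_surj[OF T]])
  define g :: "'a \<Rightarrow> ennreal" where "g = indicator (cball 0 1)"
  have [measurable]: "g \<in> borel_measurable borel"
    unfolding g_def by (intro borel_measurable_indicator) simp
  have g_T: "g (- T x) = g x" for x
    using T by (simp add: g_def indicator_def orthogonal_transformation_norm)
  define m where "m = (\<integral>\<^sup>+ x. g x \<partial>lborel)"
  have m: "m = emeasure lborel (cball (0::'a) 1)"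
    by (simp add: m_def g_def)
  have "m < \<infinity>"
    unfolding m by (rule emeasure_lborel_cball_finite)
  moreover have "m > 0"
    unfolding m by (rule emeasure_lborel_unit_cball_pos)
  moreover have "(\<integral>\<^sup>+ x. f (T x) \<partial>lborel) * m = (\<integral>\<^sup>+ x. f x \<partial>lborel) * m"
  proof -
    have "(\<integral>\<^sup>+ x. f (T x) \<partial>lborel) * m = (\<integral>\<^sup>+ x. f (T x) * (\<integral>\<^sup>+ y. g (- T x + y) \<partial>lborel) \<partial>lborel)"
      by (simp add: nn_integral_lborel_translate nn_integral_multc m_def del: uminus_add_conv_diff)
    also have "\<dots> = (\<integral>\<^sup>+ x. (\<integral>\<^sup>+ y. f (T x) * g (- T x + y) \<partial>lborel) \<partial>lborel)"
      by (simp add: nn_integral_cmult)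
    also have "\<dots> = (\<integral>\<^sup>+ y. (\<integral>\<^sup>+ x. f (T x) * g (- T x + y) \<partial>lborel) \<partial>lborel)"
      by (rule lborel_pair.Fubini') measurable
    \<comment> \<open>Shifting \<open>x\<close> by \<open>inv T y\<close> turns \<open>T x\<close>
      into \<open>y + T x\<close>, so \<open>f\<close> sees \<open>T x + y\<close> and
      \<open>g\<close> sees \<open>- T x\<close>. After the second exchange, translation in
      \<open>y\<close> removes \<open>T x\<close> altogether.\<close>
    also have "\<dots> = (\<integral>\<^sup>+ y. (\<integral>\<^sup>+ x. f (T (inv T y + x)) * g (- T (inv T y + x) + y) \<partial>lborel) \<partial>lborel)"
      by (subst nn_integral_lborel_translate[where f = "\<lambda>x. f (T x) * g (- T x + y)" for y]) auto
    also have "\<dots> = (\<integral>\<^sup>+ y. (\<integral>\<^sup>+ x. g x * f (T x + y) \<partial>lborel) \<partial>lborel)"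
      by (simp add: linear_add[OF lin] T' g_T add_ac mult_ac)
    also have "\<dots> = (\<integral>\<^sup>+ x. (\<integral>\<^sup>+ y. g x * f (T x + y) \<partial>lborel) \<partial>lborel)"
      by (rule lborel_pair.Fubini') measurable
    also have "\<dots> = (\<integral>\<^sup>+ x. f x \<partial>lborel) * m"
      by (simp add: nn_integral_lborel_translate nn_integral_multc nn_integral_cmult m_def mult_ac)
    finally show ?thesis .
  qed
  ultimately show ?thesis
    by (metis ennreal_mult_cancel_left less_irrefl mult.commute infinity_ennreal_def)
qed

subsection \<open>The uniform distribution on the sphere\<close>

lemma borel_measurable_vector_sgn [measurable]:
  "(sgn :: 'a::euclidean_space \<Rightarrow> 'a) \<in> borel_measurable borel"
  unfolding sgn_div_norm[abs_def] by measurable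

lemma nn_integral_sphere_unif:
  fixes f :: "real^'n \<Rightarrow> ennreal"
  assumes [measurable]: "f \<in> borel_measurable borel"
  shows "(\<integral>\<^sup>+ x. f x \<partial>sphere_unif) =
    (\<integral>\<^sup>+ x. f (sgn x) * indicator (cball 0 1) x \<partial>lborel) / emeasure lborel (cball (0::real^'n) 1)"
  unfolding sphere_unif_def
  by (subst nn_integral_distr) (auto simp: nn_integral_uniform_measure)

lemma sets_sphere_unif [measurable_cong]: "sets sphere_unif = sets borel"
  by (simp add: sphere_unif_def)

lemma prob_space_sphere_unif: "prob_space (sphere_unif :: (real^'n) measure)"
  unfolding sphere_unif_def
  using emeasure_lborel_unit_cball_pos[where 'a="real^'n"] emeasure_lborel_cball_finite[of "0::real^'n" 1]
  by (intro prob_space.prob_space_distr prob_space_uniform_measure) auto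

text \<open>Only almost everywhere, because \<open>sgn 0 = 0\<close>; the origin is
  Lebesgue-null.\<close>

lemma AE_sphere_unif_norm: "AE x in (sphere_unif :: (real^'n) measure). norm x = 1"
proof -
  have "AE x in lborel. x \<noteq> (0::real^'n)"
    by (rule AE_lborel_singleton)
  then have "AE x in uniform_measure lborel (cball (0::real^'n) 1). x \<noteq> 0"
    using emeasure_lborel_unit_cball_pos[where 'a="real^'n"] emeasure_lborel_cball_finite[of "0::real^'n" 1]
    by (intro AE_uniform_measureI) auto
  then show ?thesis
    unfolding sphere_unif_def
    by (subst AE_distr_iff) (auto simp: norm_sgn elim: eventually_mono)
qed

text \<open>Orthogonal maps commute with \<open>sgn\<close> and preserve the unit ball, so the
  invariance is inherited from Lebesgue measure.\<close>

lemma nn_integral_sphere_unif_orthogonal: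
  fixes f :: "real^'n \<Rightarrow> ennreal" and T :: "real^'n \<Rightarrow> real^'n"
  assumes T: "orthogonal_transformation T" and [measurable]: "f \<in> borel_measurable borel"
  shows "(\<integral>\<^sup>+ x. f (T x) \<partial>sphere_unif) = (\<integral>\<^sup>+ x. f x \<partial>sphere_unif)"
proof -
  have lin: "linear T"
    using T by (rule orthogonal_transformation_linear)
  have [measurable]: "T \<in> borel_measurable borel"
    by (rule borel_measurable_linear[OF lin])
  have "(\<integral>\<^sup>+ x. f (T (sgn x)) * indicator (cball 0 1) x \<partial>lborel)
      = (\<integral>\<^sup>+ x. f (sgn (T x)) * indicator (cball 0 1) (T x) \<partial>lborel)"
    using T by (intro nn_integral_cong)
      (simp add: sgn_div_norm linear_cmul[OF lin] orthogonal_transformation_norm indicator_def)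
  also have "\<dots> = (\<integral>\<^sup>+ x. f (sgn x) * indicator (cball 0 1) x \<partial>lborel)"
    by (rule nn_integral_lborel_orthogonal[OF T], measurable) simp
  finally show ?thesis
    by (simp add: nn_integral_sphere_unif)
qed

text \<open>Some orthogonal map takes \<open>y\<close> to \<open>z\<close>, and invariance moves it
  onto \<open>x\<close>. The measure is left general to serve both the sphere and the
  Gaussian.\<close>

lemma nn_integral_inner_cong_norm:
  fixes \<mu> :: "(real^'n) measure" and f :: "real \<Rightarrow> ennreal"
  assumes inv: "\<And>(T :: real^'n \<Rightarrow> real^'n) h. orthogonal_transformation T \<Longrightarrow> h \<in> borel_measurable borel \<Longrightarrow>
      (\<integral>\<^sup>+ x. h (T x) \<partial>\<mu>) = (\<integral>\<^sup>+ x. h x \<partial>\<mu>)"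
    and [measurable]: "f \<in> borel_measurable borel" and "norm y = norm z"
  shows "(\<integral>\<^sup>+ x. f (x \<bullet> y) \<partial>\<mu>) = (\<integral>\<^sup>+ x. f (x \<bullet> z) \<partial>\<mu>)"
proof -
  obtain T where T: "orthogonal_transformation T" "T y = z"
    using orthogonal_transformation_exists[OF \<open>norm y = norm z\<close>] .
  have "(\<integral>\<^sup>+ x. f (x \<bullet> z) \<partial>\<mu>) = (\<integral>\<^sup>+ x. f (T x \<bullet> z) \<partial>\<mu>)"
    by (rule inv[OF T(1), symmetric]) measurable
  also have "\<dots> = (\<integral>\<^sup>+ x. f (x \<bullet> y) \<partial>\<mu>)"
    using T by (auto simp: orthogonal_transformation_def)
  finally show ?thesis ..
qed

subsection \<open>The standard Gaussian measure\<close>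

definition gauss_measure :: "'a::euclidean_space measure" where
  "gauss_measure = density lborel (\<lambda>x. \<Prod>b\<in>Basis. ennreal (std_normal_density (x \<bullet> b)))"

lemma sets_gauss_measure [measurable_cong]: "sets gauss_measure = sets borel"
  by (simp add: gauss_measure_def)

text \<open>Independence of the Gaussian coordinates: it reduces the integrals below to dimension
  one.\<close>

lemma nn_integral_gauss_prod:
  fixes f :: "'a::euclidean_space \<Rightarrow> real \<Rightarrow> ennreal"
  assumes [measurable]: "\<And>b. b \<in> Basis \<Longrightarrow> f b \<in> borel_measurable borel"
  shows "(\<integral>\<^sup>+ x. (\<Prod>b\<in>Basis. f b (x \<bullet> b)) \<partial>gauss_measure) =
    (\<Prod>b\<in>Basis. \<integral>\<^sup>+ t. f b t * ennreal (std_normal_density t) \<partial>lborel)"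
proof -
  have "(\<integral>\<^sup>+ x. (\<Prod>b\<in>Basis. f b (x \<bullet> b)) \<partial>gauss_measure) =
     (\<integral>\<^sup>+ x. (\<Prod>b\<in>Basis. f b (x \<bullet> b) * ennreal (std_normal_density (x \<bullet> b))) \<partial>lborel)"
    unfolding gauss_measure_def
    by (subst nn_integral_density) (auto simp: prod.distrib mult.commute)
  also have "\<dots> = (\<Prod>b\<in>Basis. \<integral>\<^sup>+ t. f b t * ennreal (std_normal_density t) \<partial>lborel)"
    by (rule nn_integral_lborel_prod) auto
  finally show ?thesis .
qed

lemma nn_integral_normal_density:
  "0 < \<sigma> \<Longrightarrow> (\<integral>\<^sup>+ x. ennreal (normal_density \<mu> \<sigma> x) \<partial>lborel) = 1"
  by (subst nn_integral_eq_integral) auto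

lemma prob_space_gauss_measure: "prob_space (gauss_measure :: 'a::euclidean_space measure)"
proof
  show "emeasure gauss_measure (space (gauss_measure :: 'a measure)) = 1"
    using nn_integral_gauss_prod[where 'a='a and f = "\<lambda>_ _. 1"]
    by (simp add: nn_integral_normal_density)
qed

lemma nn_integral_gauss_orthogonal:
  fixes f :: "'a::euclidean_space \<Rightarrow> ennreal" and T :: "'a \<Rightarrow> 'a"
  assumes T: "orthogonal_transformation T" and [measurable]: "f \<in> borel_measurable borel"
  shows "(\<integral>\<^sup>+ x. f (T x) \<partial>gauss_measure) = (\<integral>\<^sup>+ x. f x \<partial>gauss_measure)"
proof -
  have lin: "linear T"
    using T by (rule orthogonal_transformation_linear)
  have [measurable]: "T \<in> borel_measurable borel"
    by (rule borel_measurable_linear[OF lin])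
  define d :: "'a \<Rightarrow> ennreal" where "d x = (\<Prod>b\<in>Basis. ennreal (std_normal_density (x \<bullet> b)))" for x
  have [measurable]: "d \<in> borel_measurable borel"
    unfolding d_def by measurable
  \<comment> \<open>The density depends on \<open>x\<close> only through its norm, hence is
    unchanged by \<open>T\<close>.\<close>
  have d: "d x = ennreal ((1 / sqrt (2 * pi)) ^ DIM('a) * exp (- (norm x)\<^sup>2 / 2))" for x
    by (simp add: d_def prod_ennreal std_normal_density_def prod_dividef exp_sum
        power2_norm_eq_sum_Basis sum_divide_distrib power_divide flip: sum_negf)
  have "(\<integral>\<^sup>+ x. d x * f (T x) \<partial>lborel) = (\<integral>\<^sup>+ x. d (T x) * f (T x) \<partial>lborel)"
    using T by (simp add: d orthogonal_transformation_norm)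
  also have "\<dots> = (\<integral>\<^sup>+ x. d x * f x \<partial>lborel)"
    by (rule nn_integral_lborel_orthogonal[OF T]) measurable
  finally show ?thesis
    unfolding gauss_measure_def d_def[symmetric] by (simp add: nn_integral_density)
qed

lemma nn_integral_std_normal_exp:
  "(\<integral>\<^sup>+ t. ennreal (exp (s * t)) * ennreal (std_normal_density t) \<partial>lborel) = ennreal (exp (s\<^sup>2 / 2))"
proof -
  \<comment> \<open>Completing the square: the exponential tilt moves the mean from 0 to
    \<open>s\<close>.\<close>
  have "exp (s * t) * std_normal_density t = exp (s\<^sup>2 / 2) * normal_density s 1 t" for t
    by (simp add: normal_density_def exp_add[symmetric] power2_diff field_simps)
  then have "(\<integral>\<^sup>+ t. ennreal (exp (s * t)) * ennreal (std_normal_density t) \<partial>lborel)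
     = (\<integral>\<^sup>+ t. ennreal (exp (s\<^sup>2 / 2)) * ennreal (normal_density s 1 t) \<partial>lborel)"
    by (simp add: ennreal_mult[symmetric])
  then show ?thesis
    by (simp add: nn_integral_cmult nn_integral_normal_density)
qed

lemma nn_integral_std_normal_exp_square:
  assumes "2 * m < 1"
  shows "(\<integral>\<^sup>+ t. ennreal (exp (m * t\<^sup>2)) * ennreal (std_normal_density t) \<partial>lborel)
    = ennreal ((1 - 2 * m) powr (-1/2))"
proof -
  define v where "v = 1 - 2 * m"
  have v: "v > 0" and m: "m = (1 - v) / 2"
    using assms by (auto simp: v_def)
  \<comment> \<open>The quadratic tilt changes the variance from 1 to \<open>1 / v\<close>; the
    normalising factor is the value of the integral.\<close>
  have *: "exp (m * t\<^sup>2) * std_normal_density t = v powr (-1/2) * normal_density 0 (1 / sqrt v) t" for t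
    using v unfolding normal_density_def m
    by (simp add: exp_add[symmetric] powr_minus powr_half_sqrt real_sqrt_divide real_sqrt_mult
         field_simps)
  then have "(\<integral>\<^sup>+ t. ennreal (exp (m * t\<^sup>2)) * ennreal (std_normal_density t) \<partial>lborel)
     = (\<integral>\<^sup>+ t. ennreal (v powr (-1/2)) * ennreal (normal_density 0 (1 / sqrt v) t) \<partial>lborel)"
    using v by (simp add: ennreal_mult[symmetric])
  then show ?thesis
    using v by (simp add: nn_integral_cmult nn_integral_normal_density v_def)
qed

lemma nn_integral_gauss_exp_inner:
  fixes s :: "'a::euclidean_space"
  shows "(\<integral>\<^sup>+ g. ennreal (exp (s \<bullet> g)) \<partial>gauss_measure) = ennreal (exp ((norm s)\<^sup>2 / 2))"
proof -
  have "(\<integral>\<^sup>+ g. ennreal (exp (s \<bullet> g)) \<partial>gauss_measure) =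
      (\<integral>\<^sup>+ g. (\<Prod>b\<in>Basis. ennreal (exp ((s \<bullet> b) * (g \<bullet> b)))) \<partial>gauss_measure)"
    by (subst euclidean_inner) (simp add: prod_ennreal exp_sum)
  also have "\<dots> = (\<Prod>b\<in>Basis. ennreal (exp ((s \<bullet> b)\<^sup>2 / 2)))"
    by (subst nn_integral_gauss_prod) (auto simp: nn_integral_std_normal_exp)
  also have "\<dots> = ennreal (exp ((norm s)\<^sup>2 / 2))"
    by (simp add: prod_ennreal exp_sum power2_norm_eq_sum_Basis sum_divide_distrib)
  finally show ?thesis .
qed

lemma nn_integral_gauss_exp_norm_square:
  assumes "2 * m < 1"
  shows "(\<integral>\<^sup>+ g. ennreal (exp (m * (norm g)\<^sup>2)) \<partial>(gauss_measure :: 'a::euclidean_space measure))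
    = ennreal ((1 - 2 * m) powr (- real DIM('a) / 2))"
proof -
  have "(\<integral>\<^sup>+ g. ennreal (exp (m * (norm g)\<^sup>2)) \<partial>(gauss_measure :: 'a::euclidean_space measure)) =
      (\<integral>\<^sup>+ g. (\<Prod>b\<in>Basis. ennreal (exp (m * (g \<bullet> b)\<^sup>2))) \<partial>(gauss_measure :: 'a::euclidean_space measure))"
    by (simp add: prod_ennreal exp_sum power2_norm_eq_sum_Basis sum_distrib_left)
  also have "\<dots> = (\<Prod>b\<in>(Basis :: 'a set). ennreal ((1 - 2 * m) powr (-1/2)))"
    using assms by (subst nn_integral_gauss_prod) (auto simp: nn_integral_std_normal_exp_square)
  also have "\<dots> = ennreal ((1 - 2 * m) powr (- real DIM('a) / 2))"
    using assms by (simp add: ennreal_power powr_power)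
  finally show ?thesis .
qed

lemma nn_integral_gauss_inner_even_power:
  fixes s :: "real^'n"
  shows "(\<integral>\<^sup>+ g. ennreal ((g \<bullet> s) ^ (2 * k)) \<partial>gauss_measure)
    = ennreal ((norm s) ^ (2 * k) * (fact (2 * k) / (2 ^ k * fact k)))"
proof -
  obtain b :: "real^'n" where b: "b \<in> Basis"
    using nonempty_Basis by blast
  have "(\<integral>\<^sup>+ g. ennreal ((g \<bullet> s) ^ (2 * k)) \<partial>gauss_measure)
     = (\<integral>\<^sup>+ g. ennreal ((g \<bullet> (norm s *\<^sub>R b)) ^ (2 * k)) \<partial>gauss_measure)"
    using b by (intro nn_integral_inner_cong_norm nn_integral_gauss_orthogonal) auto
  also have "\<dots> = ennreal ((norm s) ^ (2 * k)) * (\<integral>\<^sup>+ g. ennreal ((g \<bullet> b) ^ (2 * k)) \<partial>gauss_measure)"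
    by (subst nn_integral_cmult[symmetric]) (auto simp: power_mult_distrib ennreal_mult'')
  \<comment> \<open>Padding with factors 1 puts the one-coordinate moment into product form.\<close>
  also have "(\<integral>\<^sup>+ g. ennreal ((g \<bullet> b) ^ (2 * k)) \<partial>gauss_measure) =
      (\<integral>\<^sup>+ g. (\<Prod>c\<in>Basis. if c = b then ennreal ((g \<bullet> c) ^ (2 * k)) else 1) \<partial>gauss_measure)"
    using b by simp
  also have "\<dots> = (\<Prod>c\<in>Basis. \<integral>\<^sup>+ t. (if c = b then ennreal (t ^ (2 * k)) else 1) * ennreal (std_normal_density t) \<partial>lborel)"
    by (subst nn_integral_gauss_prod[symmetric]) auto
  also have "\<dots> = (\<Prod>c\<in>Basis. if c = b then ennreal (fact (2 * k) / (2 ^ k * fact k)) else 1)"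
  proof (intro prod.cong refl)
    fix c
    have "(\<integral>\<^sup>+ t. ennreal (t ^ (2 * k)) * ennreal (std_normal_density t) \<partial>lborel)
      = (\<integral>\<^sup>+ t. ennreal (std_normal_density t * t ^ (2 * k)) \<partial>lborel)"
      by (intro nn_integral_cong) (simp add: ennreal_mult mult.commute[of "ennreal (_ ^ _)"])
    also have "\<dots> = ennreal (fact (2 * k) / (2 ^ k * fact k))"
      by (subst nn_integral_eq_integral)
        (auto intro: integrable_std_normal_moment simp: integral_std_normal_moment_even)
    finally show "(\<integral>\<^sup>+ t. (if c = b then ennreal (t ^ (2 * k)) else 1) * ennreal (std_normal_density t) \<partial>lborel)
       = (if c = b then ennreal (fact (2 * k) / (2 ^ k * fact k)) else 1)"
      by (simp add: nn_integral_normal_density)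
  qed
  also have "\<dots> = ennreal (fact (2 * k) / (2 ^ k * fact k))"
    using b by simp
  finally show ?thesis
    by (simp add: ennreal_mult del: times_divide_eq_right)
qed

subsection \<open>Exponential moments of the sphere\<close>

lemma nn_integral_gauss_norm_square:
  "(\<integral>\<^sup>+ g. ennreal ((norm g)\<^sup>2) \<partial>(gauss_measure :: (real^'n) measure)) = ennreal (real CARD('n))"
proof -
  have "(\<integral>\<^sup>+ g. ennreal ((norm g)\<^sup>2) \<partial>(gauss_measure :: (real^'n) measure))
      = (\<Sum>b\<in>Basis. \<integral>\<^sup>+ g. ennreal ((g \<bullet> b) ^ (2 * 1)) \<partial>(gauss_measure :: (real^'n) measure))"
    by (subst nn_integral_sum[symmetric]) (auto simp: power2_norm_eq_sum_Basis)
  also have "\<dots> = (\<Sum>b\<in>(Basis :: (real^'n) set). 1)"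
    by (intro sum.cong refl, subst nn_integral_gauss_inner_even_power) simp
  finally show ?thesis
    by (simp add: ennreal_of_nat_eq_real_of_nat)
qed

text \<open>Dividing by this moment is what bounds the moments of the sphere from above.\<close>

lemma nn_integral_gauss_norm_even_power_ge:
  "ennreal (real CARD('n) ^ k) \<le> (\<integral>\<^sup>+ g. ennreal (norm g ^ (2 * k)) \<partial>(gauss_measure :: (real^'n) measure))"
proof -
  define N where "N = real CARD('n)"
  have N: "N > 0" by (simp add: N_def)
  interpret prob_space "gauss_measure :: (real^'n) measure"
    by (rule prob_space_gauss_measure)
  \<comment> \<open>Jensen's inequality for \<open>t ^ k\<close>, in the form of its tangent line at the mean \<open>N\<close>.\<close>
  have bern: "N ^ k + real k * N ^ k / N * (norm g)\<^sup>2 \<le> norm g ^ (2 * k) + real k * N ^ k" for g :: "real^'n"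
  proof -
    have "N ^ k * (1 + real k * ((norm g)\<^sup>2 / N - 1)) \<le> N ^ k * (1 + ((norm g)\<^sup>2 / N - 1)) ^ k"
      using N by (intro mult_left_mono Bernoulli_inequality) auto
    also have "\<dots> = norm g ^ (2 * k)"
      using N by (simp add: power_divide power_mult)
    finally show ?thesis
      by (simp add: algebra_simps)
  qed
  \<comment> \<open>The negative constant of the tangent line is kept on the other side, so that all
    terms are nonnegative; being finite, it cancels at the end.\<close>
  have "ennreal (N ^ k) + ennreal (real k * N ^ k)
      = (\<integral>\<^sup>+ g. ennreal (N ^ k) + ennreal (real k * N ^ k / N) * ennreal ((norm g)\<^sup>2) \<partial>(gauss_measure :: (real^'n) measure))"
    using N by (simp add: nn_integral_add nn_integral_cmult nn_integral_gauss_norm_square emeasure_space_1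
        flip: N_def) (simp flip: ennreal_mult)
  also have "\<dots> \<le> (\<integral>\<^sup>+ g. ennreal (norm g ^ (2 * k)) + ennreal (real k * N ^ k) \<partial>(gauss_measure :: (real^'n) measure))"
    using N bern by (intro nn_integral_mono) (simp flip: ennreal_mult ennreal_plus)
  also have "\<dots> = (\<integral>\<^sup>+ g. ennreal (norm g ^ (2 * k)) \<partial>(gauss_measure :: (real^'n) measure)) + ennreal (real k * N ^ k)"
    by (simp add: nn_integral_add emeasure_space_1)
  finally show ?thesis
    by (simp add: N_def ennreal_add_left_cancel_le add.commute)
qed

text \<open>By rotation invariance the moment of \<open>x \<bullet> y\<close> is proportional to \<open>|y|\<close> to the power \<open>2 k\<close>; averaging
  over a Gaussian \<open>y\<close> identifies the constant, since \<open>x \<bullet> y\<close> is then standard normal for each unit \<open>x\<close>.\<close>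
lemma sphere_unif_moment_gauss:
  fixes y :: "real^'n"
  shows "(\<integral>\<^sup>+ x. ennreal ((x \<bullet> y) ^ (2 * k)) \<partial>sphere_unif)
      * (\<integral>\<^sup>+ g. ennreal (norm g ^ (2 * k)) \<partial>(gauss_measure :: (real^'n) measure))
    = ennreal (norm y ^ (2 * k) * (fact (2 * k) / (2 ^ k * fact k)))"
proof -
  interpret S: prob_space "sphere_unif :: (real^'n) measure"
    by (rule prob_space_sphere_unif)
  interpret G: prob_space "gauss_measure :: (real^'n) measure"
    by (rule prob_space_gauss_measure)
  interpret SG: pair_sigma_finite "sphere_unif :: (real^'n) measure" "gauss_measure :: (real^'n) measure" ..
  \<comment> \<open>The vectors \<open>norm g *\<^sub>R y\<close> and
    \<open>norm y *\<^sub>R g\<close> have equal norm; this form of homogeneity avoids dividing by a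
    norm that may vanish.\<close>
  have swap: "ennreal (norm g ^ (2 * k)) * (\<integral>\<^sup>+ x. ennreal ((x \<bullet> y) ^ (2 * k)) \<partial>sphere_unif)
     = ennreal (norm y ^ (2 * k)) * (\<integral>\<^sup>+ x. ennreal ((x \<bullet> g) ^ (2 * k)) \<partial>sphere_unif)" for g :: "real^'n"
  proof -
    have "(\<integral>\<^sup>+ x. ennreal ((x \<bullet> (norm g *\<^sub>R y)) ^ (2 * k)) \<partial>sphere_unif)
        = (\<integral>\<^sup>+ x. ennreal ((x \<bullet> (norm y *\<^sub>R g)) ^ (2 * k)) \<partial>sphere_unif)"
      by (intro nn_integral_inner_cong_norm nn_integral_sphere_unif_orthogonal) auto
    then show ?thesis
      by (subst (1 2) nn_integral_cmult[symmetric]) (auto simp: power_mult_distrib ennreal_mult)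
  qed
  have "(\<integral>\<^sup>+ x. ennreal ((x \<bullet> y) ^ (2 * k)) \<partial>sphere_unif)
      * (\<integral>\<^sup>+ g. ennreal (norm g ^ (2 * k)) \<partial>(gauss_measure :: (real^'n) measure))
      = (\<integral>\<^sup>+ g. ennreal (norm (g :: real^'n) ^ (2 * k)) * (\<integral>\<^sup>+ x. ennreal ((x \<bullet> y) ^ (2 * k)) \<partial>sphere_unif) \<partial>gauss_measure)"
    by (subst nn_integral_multc) (auto simp: mult.commute)
  also have "\<dots> = (\<integral>\<^sup>+ g. ennreal (norm y ^ (2 * k)) * (\<integral>\<^sup>+ x. ennreal ((x \<bullet> g) ^ (2 * k)) \<partial>sphere_unif) \<partial>(gauss_measure :: (real^'n) measure))"
    by (intro nn_integral_cong swap)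
  also have "\<dots> = ennreal (norm y ^ (2 * k)) *
      (\<integral>\<^sup>+ g. (\<integral>\<^sup>+ x. ennreal ((x \<bullet> g) ^ (2 * k)) \<partial>sphere_unif) \<partial>(gauss_measure :: (real^'n) measure))"
    by (subst nn_integral_cmult) auto
  also have "(\<integral>\<^sup>+ g. (\<integral>\<^sup>+ x. ennreal ((x \<bullet> g) ^ (2 * k)) \<partial>sphere_unif) \<partial>(gauss_measure :: (real^'n) measure))
      = (\<integral>\<^sup>+ x. (\<integral>\<^sup>+ g. ennreal ((x \<bullet> g) ^ (2 * k)) \<partial>gauss_measure) \<partial>(sphere_unif :: (real^'n) measure))"
    by (rule SG.Fubini') measurable
  also have "\<dots> = (\<integral>\<^sup>+ x. ennreal (norm x ^ (2 * k) * (fact (2 * k) / (2 ^ k * fact k))) \<partial>(sphere_unif :: (real^'n) measure))"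
    by (subst inner_commute) (simp add: nn_integral_gauss_inner_even_power)
  also have "\<dots> = (\<integral>\<^sup>+ x. ennreal (fact (2 * k) / (2 ^ k * fact k)) \<partial>(sphere_unif :: (real^'n) measure))"
    using AE_sphere_unif_norm by (intro nn_integral_cong_AE) (auto elim: eventually_mono)
  also have "\<dots> = ennreal (fact (2 * k) / (2 ^ k * fact k))"
    by (simp add: S.emeasure_space_1)
  finally show ?thesis
    by (simp add: ennreal_mult del: times_divide_eq_right)
qed

lemma sphere_unif_second_moment:
  fixes y :: "real^'n"
  shows "(\<integral>\<^sup>+ x. ennreal ((x \<bullet> y)\<^sup>2) \<partial>sphere_unif) = ennreal ((norm y)\<^sup>2 / real CARD('n))"
proof -
  have "(\<integral>\<^sup>+ x. ennreal ((x \<bullet> y)\<^sup>2) \<partial>sphere_unif) * ennreal (real CARD('n)) = ennreal ((norm y)\<^sup>2)"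
    using sphere_unif_moment_gauss[of y 1] by (simp add: nn_integral_gauss_norm_square)
  also have "\<dots> = ennreal ((norm y)\<^sup>2 / real CARD('n)) * ennreal (real CARD('n))"
    by (simp flip: ennreal_mult)
  finally show ?thesis
    by (simp add: ennreal_mult_cancel_left mult.commute[of _ "ennreal (real CARD('n))"])
qed

text \<open>The right-hand side is the moment of a centred normal variable of variance
  \<open>(norm y)\<^sup>2 / N\<close>, written as \<open>fact (2 * k)\<close> times a term of an
  exponential series.\<close>

lemma sphere_unif_even_moment_le:
  fixes y :: "real^'n"
  shows "(\<integral>\<^sup>+ x. ennreal ((x \<bullet> y) ^ (2 * k)) \<partial>sphere_unif)
    \<le> ennreal (fact (2 * k) * (((norm y)\<^sup>2 / (2 * real CARD('n))) ^ k / fact k))"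
proof -
  define c where "c = real CARD('n) ^ k"
  have c: "c > 0" by (simp add: c_def)
  have "(\<integral>\<^sup>+ x. ennreal ((x \<bullet> y) ^ (2 * k)) \<partial>sphere_unif) * ennreal c
      \<le> ennreal (norm y ^ (2 * k) * (fact (2 * k) / (2 ^ k * fact k)))"
    unfolding sphere_unif_moment_gauss[symmetric] c_def
    by (intro mult_left_mono nn_integral_gauss_norm_even_power_ge) auto
  also have "\<dots> = ennreal (fact (2 * k) * (((norm y)\<^sup>2 / (2 * real CARD('n))) ^ k / fact k)) * ennreal c"
    using c by (simp add: ennreal_mult[symmetric] c_def power_divide power_mult_distrib power_mult)
  finally show ?thesis
    using c by (simp add: ennreal_mult_le_mult_iff mult.commute[of _ "ennreal c"])
qed

text \<open>Symmetry under \<open>x \<mapsto> - x\<close> removes the odd powers, leaving a series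
  of nonnegative terms.\<close>

lemma sphere_unif_exp_eq_cosh:
  fixes y :: "real^'n"
  shows "(\<integral>\<^sup>+ x. ennreal (exp (x \<bullet> y)) \<partial>sphere_unif) = (\<integral>\<^sup>+ x. ennreal (cosh (x \<bullet> y)) \<partial>sphere_unif)"
proof -
  have flip: "(\<integral>\<^sup>+ x. ennreal (exp (x \<bullet> - y)) \<partial>sphere_unif) = (\<integral>\<^sup>+ x. ennreal (exp (x \<bullet> y)) \<partial>sphere_unif)"
    by (intro nn_integral_inner_cong_norm nn_integral_sphere_unif_orthogonal) auto
  have "2 * (\<integral>\<^sup>+ x. ennreal (cosh (x \<bullet> y)) \<partial>sphere_unif)
      = (\<integral>\<^sup>+ x. ennreal (exp (x \<bullet> y)) + ennreal (exp (x \<bullet> - y)) \<partial>sphere_unif)"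
    by (subst nn_integral_cmult[symmetric])
      (auto intro!: nn_integral_cong simp: cosh_field_def ennreal_plus[symmetric]
            ennreal_mult[symmetric] ennreal_numeral[symmetric] simp del: ennreal_plus ennreal_numeral)
  also have "\<dots> = 2 * (\<integral>\<^sup>+ x. ennreal (exp (x \<bullet> y)) \<partial>sphere_unif)"
    by (subst nn_integral_add) (auto simp: flip[simplified] mult_2)
  finally show ?thesis
    by (simp add: ennreal_mult_cancel_left)
qed

lemma cosh_even_sums: "(\<lambda>k. x ^ (2 * k) / fact (2 * k)) sums cosh x" for x :: real
proof -
  have "(\<lambda>n. if even n then x ^ n /\<^sub>R fact n else 0) sums cosh x"
    by (rule cosh_converges)
  then have "(\<lambda>k. (\<lambda>n. if even n then x ^ n /\<^sub>R fact n else 0) (2 * k)) sums cosh x"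
    by (subst sums_mono_reindex) (auto simp: strict_mono_def elim!: evenE)
  then show ?thesis
    by (simp add: field_simps)
qed

text \<open>The series of \<open>cosh\<close> is integrated termwise; in the moment bounds
  \<open>fact (2 * k)\<close> cancels and the series of \<open>exp q\<close> remains.\<close>

lemma sphere_unif_exp_le:
  fixes y :: "real^'n"
  shows "(\<integral>\<^sup>+ x. ennreal (exp (x \<bullet> y)) \<partial>sphere_unif) \<le> ennreal (exp ((norm y)\<^sup>2 / (2 * real CARD('n))))"
proof -
  define q where "q = (norm y)\<^sup>2 / (2 * real CARD('n))"
  have "(\<integral>\<^sup>+ x. ennreal (exp (x \<bullet> y)) \<partial>sphere_unif)
      = (\<integral>\<^sup>+ x. (\<Sum>k. ennreal ((x \<bullet> y) ^ (2 * k) / fact (2 * k))) \<partial>sphere_unif)"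
    unfolding sphere_unif_exp_eq_cosh
    by (intro nn_integral_cong suminf_ennreal_eq[symmetric] cosh_even_sums) auto
  also have "\<dots> = (\<Sum>k. \<integral>\<^sup>+ x. ennreal ((x \<bullet> y) ^ (2 * k) / fact (2 * k)) \<partial>sphere_unif)"
    by (rule nn_integral_suminf) measurable
  also have "\<dots> = (\<Sum>k. ennreal (1 / fact (2 * k)) * (\<integral>\<^sup>+ x. ennreal ((x \<bullet> y) ^ (2 * k)) \<partial>sphere_unif))"
    by (subst nn_integral_cmult[symmetric]) (auto simp flip: ennreal_mult)
  also have "\<dots> \<le> (\<Sum>k. ennreal (1 / fact (2 * k)) * ennreal (fact (2 * k) * (q ^ k / fact k)))"
    unfolding q_def by (intro suminf_le mult_left_mono sphere_unif_even_moment_le) auto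
  also have "\<dots> = (\<Sum>k. ennreal (q ^ k / fact k))"
    by (simp add: q_def flip: ennreal_mult)
  also have "\<dots> = ennreal (exp q)"
    using exp_converges[of q] by (intro suminf_ennreal_eq) (auto simp: q_def field_simps)
  finally show ?thesis
    by (simp add: q_def)
qed

text \<open>The first two terms of the \<open>cosh\<close> series suffice, since the second moment
  is known exactly.\<close>

lemma sphere_unif_exp_ge:
  fixes y :: "real^'n"
  shows "ennreal (1 + (norm y)\<^sup>2 / (2 * real CARD('n))) \<le> (\<integral>\<^sup>+ x. ennreal (exp (x \<bullet> y)) \<partial>sphere_unif)"
proof -
  interpret S: prob_space "sphere_unif :: (real^'n) measure"
    by (rule prob_space_sphere_unif)
  have cosh_ge: "1 + 1 / 2 * t\<^sup>2 \<le> cosh t" for t :: real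
  proof -
    have "(\<Sum>k<2. t ^ (2 * k) / fact (2 * k)) \<le> cosh t"
      unfolding sums_unique[OF cosh_even_sums]
      by (rule sum_le_suminf) (auto intro: sums_summable[OF cosh_even_sums])
    then show ?thesis
      by (simp add: numeral_2_eq_2[symmetric] lessThan_nat_numeral lessThan_Suc)
  qed
  define h :: real where "h = 1 / 2"
  have h: "h \<ge> 0" "(norm y)\<^sup>2 / (2 * real CARD('n)) = h * ((norm y)\<^sup>2 / real CARD('n))"
    by (simp_all add: h_def)
  have "ennreal (1 + (norm y)\<^sup>2 / (2 * real CARD('n)))
      = 1 + ennreal h * ennreal ((norm y)\<^sup>2 / real CARD('n))"
    using h(1) unfolding h(2) by (simp flip: ennreal_mult ennreal_1 ennreal_plus)
  also have "\<dots> = (\<integral>\<^sup>+ x. 1 + ennreal h * ennreal ((x \<bullet> y)\<^sup>2) \<partial>sphere_unif)"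
    by (simp add: nn_integral_add nn_integral_cmult sphere_unif_second_moment S.emeasure_space_1)
  also have "\<dots> \<le> (\<integral>\<^sup>+ x. ennreal (cosh (x \<bullet> y)) \<partial>sphere_unif)"
    using cosh_ge[folded h_def] h(1) by (intro nn_integral_mono) (simp flip: ennreal_mult ennreal_1 ennreal_plus)
  finally show ?thesis
    by (simp add: sphere_unif_exp_eq_cosh)
qed

subsection \<open>Sums of independent spherical vectors\<close>

text \<open>The linearisation \<open>exp (|s|\<^sup>2 / 2) = E exp (s \<bullet> g)\<close> for a standard Gaussian \<open>g\<close>
  makes the square of the sum factorise over the independent summands.\<close>
lemma (in prob_space) nn_integral_exp_norm_square_sum:
  fixes Y :: "nat \<Rightarrow> 'a \<Rightarrow> real^'n"
  assumes I: "finite I" and indep: "indep_vars (\<lambda>_. borel) Y I"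
    and distr: "\<And>j. j \<in> I \<Longrightarrow> distr M borel (Y j) = sphere_unif" and l: "l \<ge> 0"
  shows "(\<integral>\<^sup>+ \<omega>. ennreal (exp (l * (norm (\<Sum>j\<in>I. a j *\<^sub>R Y j \<omega>))\<^sup>2)) \<partial>M)
    = (\<integral>\<^sup>+ g. (\<Prod>j\<in>I. \<integral>\<^sup>+ x. ennreal (exp (x \<bullet> ((sqrt (2 * l) * a j) *\<^sub>R g))) \<partial>sphere_unif)
        \<partial>(gauss_measure :: (real^'n) measure))"
proof -
  interpret G: prob_space "gauss_measure :: (real^'n) measure"
    by (rule prob_space_gauss_measure)
  interpret MG: pair_sigma_finite M "gauss_measure :: (real^'n) measure" ..
  have meas: "Y j \<in> borel_measurable M" if "j \<in> I" for j
    using indep that by (auto simp: indep_vars_def)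
  define h where "h j g x = ennreal (exp (x \<bullet> ((sqrt (2 * l) * a j) *\<^sub>R g)))" for j and g x :: "real^'n"
  have [measurable]: "(\<lambda>x. h j g x) \<in> borel_measurable borel" for j g
    unfolding h_def by measurable
  have exp_eq: "ennreal (exp (l * (norm (\<Sum>j\<in>I. a j *\<^sub>R Y j \<omega>))\<^sup>2))
      = (\<integral>\<^sup>+ g. (\<Prod>j\<in>I. h j g (Y j \<omega>)) \<partial>gauss_measure)" for \<omega>
  proof -
    \<comment> \<open>The factor \<open>sqrt (2 * l)\<close> makes
      \<open>(norm s)\<^sup>2 / 2\<close> equal to \<open>l\<close> times the squared norm of the
      sum.\<close>
    define s where "s = sqrt (2 * l) *\<^sub>R (\<Sum>j\<in>I. a j *\<^sub>R Y j \<omega>)"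
    have "l * (norm (\<Sum>j\<in>I. a j *\<^sub>R Y j \<omega>))\<^sup>2 = (norm s)\<^sup>2 / 2"
      using l by (simp add: s_def power_mult_distrib)
    moreover have "ennreal (exp (s \<bullet> g)) = (\<Prod>j\<in>I. h j g (Y j \<omega>))" for g
      using I by (simp add: s_def h_def prod_ennreal inner_sum_left sum_distrib_left mult.assoc flip: exp_sum)
    ultimately show ?thesis
      using nn_integral_gauss_exp_inner[of s] by simp
  qed
  have "(\<integral>\<^sup>+ \<omega>. ennreal (exp (l * (norm (\<Sum>j\<in>I. a j *\<^sub>R Y j \<omega>))\<^sup>2)) \<partial>M)
      = (\<integral>\<^sup>+ \<omega>. (\<integral>\<^sup>+ g. (\<Prod>j\<in>I. h j g (Y j \<omega>)) \<partial>gauss_measure) \<partial>M)"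
    by (simp add: exp_eq)
  also have "\<dots> = (\<integral>\<^sup>+ g. (\<integral>\<^sup>+ \<omega>. (\<Prod>j\<in>I. h j g (Y j \<omega>)) \<partial>M) \<partial>gauss_measure)"
  proof (rule MG.Fubini'[symmetric])
    have "(\<lambda>p. h j (snd p) (Y j (fst p))) \<in> borel_measurable (M \<Otimes>\<^sub>M gauss_measure)" if "j \<in> I" for j
      unfolding h_def using meas[OF that] by measurable
    then show "case_prod (\<lambda>\<omega> g. \<Prod>j\<in>I. h j g (Y j \<omega>)) \<in> borel_measurable (M \<Otimes>\<^sub>M gauss_measure)"
      unfolding case_prod_beta by (intro borel_measurable_prod_ennreal)
  qed
  also have "\<dots> = (\<integral>\<^sup>+ g. (\<Prod>j\<in>I. \<integral>\<^sup>+ x. h j g x \<partial>sphere_unif) \<partial>gauss_measure)"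
  proof (rule nn_integral_cong)
    fix g
    \<comment> \<open>For fixed \<open>g\<close> each factor is a function of a single
      \<open>Y j\<close>, so independence applies.\<close>
    have "(\<integral>\<^sup>+ \<omega>. (\<Prod>j\<in>I. h j g (Y j \<omega>)) \<partial>M) = (\<Prod>j\<in>I. \<integral>\<^sup>+ \<omega>. h j g (Y j \<omega>) \<partial>M)"
      by (intro indep_vars_nn_integral I indep_vars_compose2[OF indep]) auto
    also have "\<dots> = (\<Prod>j\<in>I. \<integral>\<^sup>+ x. h j g x \<partial>sphere_unif)"
    proof (intro prod.cong refl)
      fix j assume j: "j \<in> I"
      show "(\<integral>\<^sup>+ \<omega>. h j g (Y j \<omega>) \<partial>M) = (\<integral>\<^sup>+ x. h j g x \<partial>sphere_unif)"
        unfolding distr[OF j, symmetric] using meas[OF j] by (subst nn_integral_distr) auto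
    qed
    finally show "(\<integral>\<^sup>+ \<omega>. (\<Prod>j\<in>I. h j g (Y j \<omega>)) \<partial>M) = (\<Prod>j\<in>I. \<integral>\<^sup>+ x. h j g x \<partial>sphere_unif)" .
  qed
  finally show ?thesis
    by (simp add: h_def)
qed

text \<open>The bound on the Laplace transform depends on the weights only through the sum of their
  squares. The hypothesis \<open>small\<close> is the convergence condition of the resulting
  Gaussian integral.\<close>

lemma (in prob_space) nn_integral_exp_norm_square_sum_le:
  fixes Y :: "nat \<Rightarrow> 'a \<Rightarrow> real^'n"
  assumes I: "finite I" and indep: "indep_vars (\<lambda>_. borel) Y I"
    and distr: "\<And>j. j \<in> I \<Longrightarrow> distr M borel (Y j) = sphere_unif" and l: "l \<ge> 0"
    and small: "2 * (l * (\<Sum>j\<in>I. (a j)\<^sup>2) / real CARD('n)) < 1"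
  shows "(\<integral>\<^sup>+ \<omega>. ennreal (exp (l * (norm (\<Sum>j\<in>I. a j *\<^sub>R Y j \<omega>))\<^sup>2)) \<partial>M)
    \<le> ennreal ((1 - 2 * (l * (\<Sum>j\<in>I. (a j)\<^sup>2) / real CARD('n))) powr (- real CARD('n) / 2))"
proof -
  have "(\<integral>\<^sup>+ \<omega>. ennreal (exp (l * (norm (\<Sum>j\<in>I. a j *\<^sub>R Y j \<omega>))\<^sup>2)) \<partial>M)
    = (\<integral>\<^sup>+ g. (\<Prod>j\<in>I. \<integral>\<^sup>+ x. ennreal (exp (x \<bullet> ((sqrt (2 * l) * a j) *\<^sub>R g))) \<partial>sphere_unif)
        \<partial>(gauss_measure :: (real^'n) measure))"
    by (rule nn_integral_exp_norm_square_sum[OF I indep distr l])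
  also have "\<dots> \<le> (\<integral>\<^sup>+ g. (\<Prod>j\<in>I. ennreal (exp ((norm ((sqrt (2 * l) * a j) *\<^sub>R g))\<^sup>2 / (2 * real CARD('n)))))
        \<partial>(gauss_measure :: (real^'n) measure))"
    by (intro nn_integral_mono prod_mono_ennreal sphere_unif_exp_le)
  also have "\<dots> = (\<integral>\<^sup>+ g. ennreal (exp (l * (\<Sum>j\<in>I. (a j)\<^sup>2) / real CARD('n) * (norm g)\<^sup>2))
        \<partial>(gauss_measure :: (real^'n) measure))"
    using I l by (intro nn_integral_cong)
      (simp add: prod_ennreal power_mult_distrib sum_distrib_left sum_distrib_right sum_divide_distrib mult.assoc
        flip: exp_sum)
  also have "\<dots> = ennreal ((1 - 2 * (l * (\<Sum>j\<in>I. (a j)\<^sup>2) / real CARD('n))) powr (- real CARD('n) / 2))"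
    using nn_integral_gauss_exp_norm_square[OF small, where 'a="real^'n"] by simp
  finally show ?thesis .
qed

section \<open>The constant \<open>bconst\<close> as the critical Gaussian scale\<close>

lemma half_powr_less_1: "N \<ge> 1 \<Longrightarrow> (1/2) powr (2 / real N) < (1::real)"
  using powr_less_mono2[of "2 / real N" "1/2" 1] by simp

text \<open>Scales above \<open>sqrt (2 / N)\<close> are those at which the limiting Gaussian
  integral is finite; the optimality argument works in the gap below
  \<open>bconst N\<close>.\<close>

lemma bconst_gt: "N \<ge> 1 \<Longrightarrow> sqrt (2 / real N) < bconst N"
  unfolding bconst_def using half_powr_less_1[of N] by simp

lemma bconst_pos: "N \<ge> 1 \<Longrightarrow> 0 < bconst N"
  using bconst_gt[of N] by (rule le_less_trans[rotated]) simp_all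

text \<open>Together with the next lemma this says that \<open>bconst N\<close> solves
  \<open>(1 - 2 / (N * b\<^sup>2)) powr (- N / 2) = 2\<close> for \<open>b\<close>.\<close>

lemma two_div_bconst_square: "N \<ge> 1 \<Longrightarrow> 2 / (real N * (bconst N)\<^sup>2) = 1 - (1/2) powr (2 / real N)"
proof -
  assume N: "N \<ge> 1"
  define q where "q = 1 - (1/2) powr (2 / real N)"
  have "q > 0"
    using half_powr_less_1[OF N] by (simp add: q_def)
  then have "(bconst N)\<^sup>2 = 2 / real N * (1 / q)"
    by (simp add: bconst_def power_mult_distrib flip: q_def)
  then show ?thesis
    using N \<open>q > 0\<close> by (simp flip: q_def)
qed

lemma half_powr_powr_eq_2: "N \<ge> 1 \<Longrightarrow> ((1/2) powr (2 / real N)) powr (- real N / 2) = 2"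
  by (simp add: powr_powr powr_minus)

lemma (in prob_space) nn_integral_exp_bconst_le_2:
  fixes Y :: "nat \<Rightarrow> 'a \<Rightarrow> real^'n"
  assumes I: "finite I" and indep: "indep_vars (\<lambda>_. borel) Y I"
    and distr: "\<And>j. j \<in> I \<Longrightarrow> distr M borel (Y j) = sphere_unif"
    and pos: "(\<Sum>j\<in>I. (a j)\<^sup>2) > 0"
  shows "(\<integral>\<^sup>+ \<omega>. ennreal (exp ((norm (\<Sum>j\<in>I. a j *\<^sub>R Y j \<omega>))\<^sup>2
      / (bconst CARD('n) * sqrt (\<Sum>j\<in>I. (a j)\<^sup>2))\<^sup>2)) \<partial>M) \<le> 2"
proof -
  define A where "A = (\<Sum>j\<in>I. (a j)\<^sup>2)"
  define l where "l = 1 / (bconst CARD('n) * sqrt A)\<^sup>2"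
  have N: "CARD('n) \<ge> 1"
    by (simp add: Suc_le_eq)
  have l: "l \<ge> 0"
    by (simp add: l_def)
  \<comment> \<open>The scale contains \<open>sqrt A\<close>, so \<open>l * A\<close> no longer
    depends on the weights.\<close>
  have lA: "2 * (l * A / real CARD('n)) = 1 - (1/2) powr (2 / real CARD('n))"
    using pos bconst_pos[OF N] unfolding two_div_bconst_square[OF N, symmetric]
    by (simp add: l_def A_def[symmetric] field_simps)
  have "(\<integral>\<^sup>+ \<omega>. ennreal (exp (l * (norm (\<Sum>j\<in>I. a j *\<^sub>R Y j \<omega>))\<^sup>2)) \<partial>M)
    \<le> ennreal ((1 - 2 * (l * A / real CARD('n))) powr (- real CARD('n) / 2))"
    unfolding A_def using lA
    by (intro nn_integral_exp_norm_square_sum_le I indep distr l) (simp_all add: A_def)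
  also have "\<dots> = 2"
    by (simp only: lA diff_diff_eq2 add_diff_cancel_left' half_powr_powr_eq_2[OF N]) simp
  finally show ?thesis
    by (simp add: l_def A_def)
qed

section \<open>The Orlicz norm: the upper bound and its optimality\<close>

lemma psi2_norm_le:
  assumes "c > 0" "(\<integral>\<^sup>+ \<omega>. ennreal (exp ((norm (Z \<omega>))\<^sup>2 / c\<^sup>2)) \<partial>M) \<le> 2"
  shows "psi2_norm M Z \<le> c"
  unfolding psi2_norm_def using assms by (intro cInf_lower bdd_belowI[of _ 0]) auto

text \<open>The integral is antitone in the scale, so failure at \<open>c\<close> rules out every
  smaller scale. The scale \<open>d\<close> shows that the set is nonempty, without which
  \<open>Inf\<close> gives no information.\<close>

lemma psi2_norm_ge:
  assumes "c > 0" "(\<integral>\<^sup>+ \<omega>. ennreal (exp ((norm (Z \<omega>))\<^sup>2 / c\<^sup>2)) \<partial>M) > 2"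
    and "d > 0" "(\<integral>\<^sup>+ \<omega>. ennreal (exp ((norm (Z \<omega>))\<^sup>2 / d\<^sup>2)) \<partial>M) \<le> 2"
  shows "c \<le> psi2_norm M Z"
  unfolding psi2_norm_def
proof (rule cInf_greatest)
  show "{c. c > 0 \<and> (\<integral>\<^sup>+ \<omega>. ennreal (exp ((norm (Z \<omega>))\<^sup>2 / c\<^sup>2)) \<partial>M) \<le> 2} \<noteq> {}"
    using assms(3,4) by blast
next
  fix e assume "e \<in> {c. c > 0 \<and> (\<integral>\<^sup>+ \<omega>. ennreal (exp ((norm (Z \<omega>))\<^sup>2 / c\<^sup>2)) \<partial>M) \<le> 2}"
  then have e: "e > 0" "(\<integral>\<^sup>+ \<omega>. ennreal (exp ((norm (Z \<omega>))\<^sup>2 / e\<^sup>2)) \<partial>M) \<le> 2"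
    by auto
  show "c \<le> e"
  proof (rule ccontr)
    assume "\<not> c \<le> e"
    then have "(\<integral>\<^sup>+ \<omega>. ennreal (exp ((norm (Z \<omega>))\<^sup>2 / c\<^sup>2)) \<partial>M)
        \<le> (\<integral>\<^sup>+ \<omega>. ennreal (exp ((norm (Z \<omega>))\<^sup>2 / e\<^sup>2)) \<partial>M)"
      using e(1) by (intro nn_integral_mono ennreal_leI) (auto intro!: divide_left_mono power_mono)
    then show False
      using e(2) assms(2) by (meson leD order_trans)
  qed
qed

lemma (in prob_space) psi2_norm_sum_le:
  fixes Y :: "nat \<Rightarrow> 'a \<Rightarrow> real^'n"
  assumes I: "finite I" and indep: "indep_vars (\<lambda>_. borel) Y I"
    and distr: "\<And>j. j \<in> I \<Longrightarrow> distr M borel (Y j) = sphere_unif"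
  shows "psi2_norm M (\<lambda>\<omega>. \<Sum>j\<in>I. a j *\<^sub>R Y j \<omega>) \<le> bconst CARD('n) * sqrt (\<Sum>j\<in>I. (a j)\<^sup>2)"
proof (cases "(\<Sum>j\<in>I. (a j)\<^sup>2) > 0")
  case True
  then show ?thesis
    using bconst_pos[of "CARD('n)"] assms
    by (intro psi2_norm_le nn_integral_exp_bconst_le_2 mult_pos_pos) (auto simp: Suc_le_eq)
next
  case False
  then have zero: "(\<Sum>j\<in>I. (a j)\<^sup>2) = 0"
    by (simp add: sum_nonneg order_antisym not_less)
  then have "\<forall>j\<in>I. a j = 0"
    using I by (simp add: sum_nonneg_eq_0_iff)
  then have "(\<Sum>j\<in>I. a j *\<^sub>R Y j \<omega>) = 0" for \<omega>
    by simp
  \<comment> \<open>Scale 0 is not admissible, but for the zero vector every positive scale is, so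
    the infimum is at most any positive number.\<close>
  then have "psi2_norm M (\<lambda>\<omega>. \<Sum>j\<in>I. a j *\<^sub>R Y j \<omega>) \<le> 0"
    by (intro field_le_epsilon[OF psi2_norm_le]) (simp_all add: emeasure_space_1)
  then show ?thesis
    by (simp add: zero)
qed

text \<open>Fatou's lemma and \<open>(1 + t / n) ^ n \<longlonglongrightarrow> exp t\<close> replace the central limit theorem here.\<close>
lemma (in prob_space) exists_nn_integral_exp_gt_2:
  fixes X :: "nat \<Rightarrow> 'a \<Rightarrow> real^'n"
  assumes indep: "indep_vars (\<lambda>_. borel) X UNIV"
    and distr: "\<And>j. distr M borel (X j) = sphere_unif"
    and c: "sqrt (2 / real CARD('n)) < c" "c < bconst CARD('n)"
  shows "\<exists>n\<ge>1. (\<integral>\<^sup>+ \<omega>. ennreal (exp ((norm (\<Sum>j=1..n. X j \<omega>))\<^sup>2 / (c * sqrt (real n))\<^sup>2)) \<partial>M) > 2"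
proof (rule ccontr)
  assume "\<not> ?thesis"
  then have le2: "(\<integral>\<^sup>+ \<omega>. ennreal (exp ((norm (\<Sum>j=1..n. X j \<omega>))\<^sup>2 / (c * sqrt (real n))\<^sup>2)) \<partial>M) \<le> 2"
    if "n \<ge> 1" for n
    using that by (meson not_less)
  define N where "N = real CARD('n)"
  have N1: "CARD('n) \<ge> 1"
    by (simp add: Suc_le_eq)
  then have N: "N > 0"
    by (simp add: N_def)
  have "0 \<le> sqrt (2 / N)"
    using N by simp
  then have c0: "c > 0"
    using c(1) unfolding N_def by linarith
  have c2: "2 / N < c\<^sup>2"
    using power_strict_mono[OF c(1), of 2] by (simp add: N_def)
  define l where "l = 1 / c\<^sup>2"
  have l: "l > 0"
    using c0 by (simp add: l_def)
  have small: "2 * (l / N) < 1"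
    using c2 c0 N by (simp add: l_def field_simps)
  \<comment> \<open>At \<open>bconst\<close> equality would hold; the smaller scale \<open>c\<close>
    makes the base strictly smaller.\<close>
  have large: "1 - 2 * (l / N) < (1/2) powr (2 / N)"
  proof -
    have "c\<^sup>2 < (bconst CARD('n))\<^sup>2"
      using c(2) c0 by (intro power_strict_mono) auto
    then have "2 / (N * (bconst CARD('n))\<^sup>2) < 2 / (N * c\<^sup>2)"
      using N c0 by (intro divide_strict_left_mono mult_strict_left_mono mult_pos_pos) auto
    then show ?thesis
      using two_div_bconst_square[OF N1] by (simp add: N_def l_def mult.commute)
  qed
  \<comment> \<open>The lower bound on the Laplace transform, multiplied over \<open>n\<close>
    summands of weight 1 with \<open>l / n\<close> in place of \<open>l\<close>.\<close>
  define u where "u n g = ennreal ((1 + l / N * (norm g)\<^sup>2 / real n) ^ n)" for n and g :: "real^'n"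
  have u_le: "(\<integral>\<^sup>+ g. u n g \<partial>gauss_measure) \<le> 2" if n: "n \<ge> 1" for n
  proof -
    have pr: "u n g \<le> (\<Prod>j\<in>{1..n}. \<integral>\<^sup>+ x. ennreal (exp (x \<bullet> ((sqrt (2 * (l / real n)) * 1) *\<^sub>R g))) \<partial>sphere_unif)" for g
    proof -
      have "u n g = (\<Prod>j\<in>{1..n}. ennreal (1 + (norm ((sqrt (2 * (l / real n)) * 1) *\<^sub>R g))\<^sup>2 / (2 * real CARD('n))))"
        using n l N by (simp add: u_def ennreal_power power_mult_distrib N_def mult.commute[of "real n"] del: ennreal_plus)
      also have "\<dots> \<le> (\<Prod>j\<in>{1..n}. \<integral>\<^sup>+ x. ennreal (exp (x \<bullet> ((sqrt (2 * (l / real n)) * 1) *\<^sub>R g))) \<partial>sphere_unif)"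
        by (intro prod_mono_ennreal sphere_unif_exp_ge)
      finally show ?thesis .
    qed
    have "(\<integral>\<^sup>+ g. u n g \<partial>gauss_measure)
      \<le> (\<integral>\<^sup>+ g. (\<Prod>j\<in>{1..n}. \<integral>\<^sup>+ x. ennreal (exp (x \<bullet> ((sqrt (2 * (l / real n)) * 1) *\<^sub>R g))) \<partial>sphere_unif)
          \<partial>(gauss_measure :: (real^'n) measure))"
      by (intro nn_integral_mono pr)
    also have "\<dots> = (\<integral>\<^sup>+ \<omega>. ennreal (exp (l / real n * (norm (\<Sum>j=1..n. 1 *\<^sub>R X j \<omega>))\<^sup>2)) \<partial>M)"
      using l by (intro nn_integral_exp_norm_square_sum[symmetric] indep_vars_subset[OF indep] distr) auto
    also have "\<dots> \<le> 2"
      using le2[OF n] by (simp add: l_def power_mult_distrib)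
    finally show ?thesis .
  qed
  have [measurable]: "u n \<in> borel_measurable borel" for n
    unfolding u_def by measurable
  have "ennreal ((1 - 2 * (l / N)) powr (- N / 2))
      = (\<integral>\<^sup>+ g. ennreal (exp (l / N * (norm g)\<^sup>2)) \<partial>(gauss_measure :: (real^'n) measure))"
    using nn_integral_gauss_exp_norm_square[OF small, where 'a="real^'n"] by (simp add: N_def)
  also have "\<dots> = (\<integral>\<^sup>+ g. liminf (\<lambda>n. u n g) \<partial>gauss_measure)"
  proof (intro nn_integral_cong lim_imp_Liminf[symmetric])
    show "(\<lambda>n. u n g) \<longlonglongrightarrow> ennreal (exp (l / N * (norm g)\<^sup>2))" for g
      unfolding u_def by (intro tendsto_ennrealI tendsto_exp_limit_sequentially)
  qed auto
  also have "\<dots> \<le> liminf (\<lambda>n. \<integral>\<^sup>+ g. u n g \<partial>gauss_measure)"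
    by (rule nn_integral_liminf) measurable
  also have "\<dots> \<le> liminf (\<lambda>n. 2)"
    using u_le by (intro Liminf_mono eventually_sequentiallyI[of 1])
  also have "\<dots> = 2"
    by (simp add: Liminf_const)
  finally have "(1 - 2 * (l / N)) powr (- N / 2) \<le> 2"
    by (simp flip: ennreal_numeral)
  \<comment> \<open>The negative exponent reverses \<open>large\<close>: the limiting Gaussian
    integral exceeds 2, against the bound just obtained.\<close>
  moreover have "((1/2) powr (2 / N)) powr (- N / 2) < (1 - 2 * (l / N)) powr (- N / 2)"
    using large small N by (intro powr_less_mono2_neg) auto
  ultimately show False
    using half_powr_powr_eq_2[OF N1] by (simp add: N_def)
qed

theorem theorem1:
  fixes M :: "'s measure" and X :: "nat \<Rightarrow> 's \<Rightarrow> real ^ 'n"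
  assumes "prob_space M"
    and "prob_space.indep_vars M (\<lambda>_. borel) X UNIV"
    and "\<And>j. distr M borel (X j) = sphere_unif"
  shows "(\<forall>(M' :: 't measure) (Y :: nat \<Rightarrow> 't \<Rightarrow> real ^ 'n) (n::nat) (a :: nat \<Rightarrow> real).
            prob_space M' \<and> n \<ge> 1 \<and> prob_space.indep_vars M' (\<lambda>_. borel) Y {1..n} \<and>
            (\<forall>j\<in>{1..n}. distr M' borel (Y j) = sphere_unif) \<longrightarrow>
            psi2_norm M' (\<lambda>\<omega>. \<Sum>j=1..n. a j *\<^sub>R Y j \<omega>)
              \<le> bconst CARD('n) * sqrt (\<Sum>j=1..n. (a j)\<^sup>2))
      \<and> (\<forall>c < bconst CARD('n). \<exists>(n::nat) (a :: nat \<Rightarrow> real). n \<ge> 1 \<and>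
            psi2_norm M (\<lambda>\<omega>. \<Sum>j=1..n. a j *\<^sub>R X j \<omega>) > c * sqrt (\<Sum>j=1..n. (a j)\<^sup>2))"
proof (intro conjI allI impI)
  fix M' :: "'t measure" and Y :: "nat \<Rightarrow> 't \<Rightarrow> real ^ 'n" and n :: nat and a :: "nat \<Rightarrow> real"
  assume "prob_space M' \<and> n \<ge> 1 \<and> prob_space.indep_vars M' (\<lambda>_. borel) Y {1..n} \<and>
    (\<forall>j\<in>{1..n}. distr M' borel (Y j) = sphere_unif)"
  then show "psi2_norm M' (\<lambda>\<omega>. \<Sum>j=1..n. a j *\<^sub>R Y j \<omega>) \<le> bconst CARD('n) * sqrt (\<Sum>j=1..n. (a j)\<^sup>2)"
    by (intro prob_space.psi2_norm_sum_le) auto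
next
  fix c assume c: "c < bconst CARD('n)"
  interpret prob_space M by fact
  have N1: "CARD('n) \<ge> 1"
    by (simp add: Suc_le_eq)
  \<comment> \<open>Exceeding \<open>c\<close> leaves room for a strict inequality at the end;
    exceeding the square root gives positivity, as \<open>c\<close> may be negative, and convergence
    of the Gaussian integral.\<close>
  obtain d where d: "max c (sqrt (2 / real CARD('n))) < d" "d < bconst CARD('n)"
    using c bconst_gt[OF N1] dense[of "max c (sqrt (2 / real CARD('n)))" "bconst CARD('n)"] by auto
  have "0 \<le> sqrt (2 / real CARD('n))"
    by simp
  then have d0: "d > 0"
    using d(1) by linarith
  obtain n where n: "n \<ge> 1"
      "(\<integral>\<^sup>+ \<omega>. ennreal (exp ((norm (\<Sum>j=1..n. X j \<omega>))\<^sup>2 / (d * sqrt (real n))\<^sup>2)) \<partial>M) > 2"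
    using exists_nn_integral_exp_gt_2[OF assms(2,3)] d by auto
  \<comment> \<open>The upper bound with unit weights supplies the admissible scale that
    \<open>psi2_norm_ge\<close> requires.\<close>
  have "(\<integral>\<^sup>+ \<omega>. ennreal (exp ((norm (\<Sum>j=1..n. 1 *\<^sub>R X j \<omega>))\<^sup>2
      / (bconst CARD('n) * sqrt (\<Sum>j=1..n. 1\<^sup>2))\<^sup>2)) \<partial>M) \<le> 2"
    using n(1) by (intro nn_integral_exp_bconst_le_2 indep_vars_subset[OF assms(2)] assms(3)) auto
  then have "d * sqrt (real n) \<le> psi2_norm M (\<lambda>\<omega>. \<Sum>j=1..n. X j \<omega>)"
    using n d0 bconst_pos[OF N1]
    by (intro psi2_norm_ge[where d = "bconst CARD('n) * sqrt (real n)"]) auto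
  moreover have "c * sqrt (real n) < d * sqrt (real n)"
    using n(1) d(1) by simp
  ultimately have "c * sqrt (real n) < psi2_norm M (\<lambda>\<omega>. \<Sum>j=1..n. X j \<omega>)"
    by linarith
  then show "\<exists>(n::nat) (a :: nat \<Rightarrow> real). n \<ge> 1 \<and>
      psi2_norm M (\<lambda>\<omega>. \<Sum>j=1..n. a j *\<^sub>R X j \<omega>) > c * sqrt (\<Sum>j=1..n. (a j)\<^sup>2)"
    using n(1) by (intro exI[of _ n] exI[of _ "\<lambda>_. 1"]) simp
qed

end
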